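(* Let $G$ be a group with a finite generating set $X$, let $\mathcal C$ be a class of (finitely described) subsets of $G$, and let $\mathcal L$ be a class of (finitely described) languages. Suppose that the following hold: (i) if $U,V\in\mathcal C$, then $\mathrm{ConjGeo}_X(U,V)\in\mathcal L$ and it can be computed from $U,V$; (ii) if $U\in\mathcal C$ and $g\in G$, then $Ug\in\mathcal C$ and it can be computed from $U$ and $g$; (iii) $G$ has decidable conjugacy problem; (iv) $\mathcal L$ has decidable membership problem (given a language $L\in\mathcal L$ and a word $w$, one can decide whether $w\in L$). Then $G$ has a decidable $\mathcal C$-generalized conjugacy problem with $\mathcal C$-constraints.
   Context: Let $G$ be a group with finite generating set $X\subseteq G$, let $\widetilde X=X\cup X^{-1}$ and let $\pi:\widetilde X^*\to G$ be the canonical surjective monoid homomorphism. For $g\in G$, $|g|$ is the length of a shortest word over $\widetilde X$ representing $g$, and $|g|_c=\min\{|h| : h \text{ conjugate to } g\}$; $\ell(w)$ is the length of a word $w$. For $U,V\subseteq G$ put $\alpha(U,V)=\bigcup_{v\in V}v^{-1}Uv$, and $$\mathrm{ConjGeo}_X(U,V)=\{w\in\widetilde X^* : \ell(w)=|w\pi|_c \text{ and } w\pi\in\alpha(U,V)\}.$$ The conjugacy problem for $G$ is: given $x,y\in G$ (as words), decide whether $x$ and $y$ are conjugate in $G$. The $\mathcal C$-generalized conjugacy problem with $\mathcal C$-constraints is: given $g\in G$ (as a word) and $U,V\in\mathcal C$, decide whether there exist $u\in U$ and $v\in V$ with $g=v^{-1}uv$. Members of $\mathcal C$ and of $\mathcal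 L$ are given to algorithms by finite descriptions; "can be computed" means that such a description can be computed from descriptions of the inputs. *)

theory Defs
  imports "HOL-Algebra.Generated_Groups" "HOL-Library.Nat_Bijection"
begin

text \<open>
  The partial recursive functions (Kleene), presented for unary functions: a function of several
  arguments is a function of the code of the tuple of its arguments under the Cantor pairing
  \<open>prod_encode\<close>. The value \<open>None\<close> means divergence.
\<close>

inductive partial_recursive :: "(nat \<Rightarrow> nat option) \<Rightarrow> bool" where
  rec_zero: "partial_recursive (\<lambda>_. Some 0)"
| rec_succ: "partial_recursive (\<lambda>n. Some (Suc n))"
| rec_left: "partial_recursive (\<lambda>n. Some (fst (prod_decode n)))"
| rec_right: "partial_recursive (\<lambda>n. Some (snd (prod_decode n)))"
| rec_pair: "partial_recursive f \<Longrightarrow> partial_recursive g \<Longrightarrow>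
    partial_recursive (\<lambda>n. Option.bind (f n) (\<lambda>a.
      Option.bind (g n) (\<lambda>b. Some (prod_encode (a, b)))))"
| rec_comp: "partial_recursive f \<Longrightarrow> partial_recursive g \<Longrightarrow>
    partial_recursive (\<lambda>n. Option.bind (g n) f)"
| rec_prec: "partial_recursive f \<Longrightarrow> partial_recursive g \<Longrightarrow>
    partial_recursive (\<lambda>n. rec_nat (f (fst (prod_decode n)))
      (\<lambda>k r. Option.bind r (\<lambda>i. g (prod_encode (fst (prod_decode n), prod_encode (k, i)))))
      (snd (prod_decode n)))"
| rec_mu: "partial_recursive f \<Longrightarrow>
    partial_recursive (\<lambda>n.
      if \<exists>m. f (prod_encode (n, m)) = Some 0 \<and> (\<forall>k<m. \<exists>y. f (prod_encode (n, k)) = Some (Suc y))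
      then Some (LEAST m. f (prod_encode (n, m)) = Some 0)
      else None)"

text \<open>
  A decision problem consists of a set \<open>I\<close> of instances, a coding of the instances, and a property
  \<open>Q\<close>. As usual for inputs given by descriptions, an algorithm only has to halt with the right
  answer on codes of instances.
\<close>

definition decidable_problem :: "'i set \<Rightarrow> ('i \<Rightarrow> nat) \<Rightarrow> ('i \<Rightarrow> bool) \<Rightarrow> bool" where
  "decidable_problem I code Q \<longleftrightarrow>
     (\<exists>f. partial_recursive f \<and> (\<forall>i\<in>I. f (code i) = Some (if Q i then 1 else 0)))"

text \<open>
  A class of finitely described objects is given by a partial map \<open>\<nu>\<close> from natural numbers (codes of
  finite descriptions) to objects: \<open>\<nu> d = Some x\<close> means that \<open>d\<close> describes \<open>x\<close>. An object may have
  many descriptions, and neither the set of descriptions nor equality of the described objects is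
  required to be decidable.
\<close>

definition finitely_described :: "'o set \<Rightarrow> (nat \<Rightarrow> 'o option) \<Rightarrow> bool" where
  "finitely_described K \<nu> \<longleftrightarrow> ran \<nu> = K"

definition computable_description ::
    "'i set \<Rightarrow> ('i \<Rightarrow> nat) \<Rightarrow> ('i \<Rightarrow> 'o) \<Rightarrow> (nat \<Rightarrow> 'o option) \<Rightarrow> bool" where
  "computable_description I code F \<nu> \<longleftrightarrow>
     (\<exists>f. partial_recursive f \<and> (\<forall>i\<in>I. \<exists>d. f (code i) = Some d \<and> \<nu> d = Some (F i)))"

definition sym_gens :: "('a, 'b) monoid_scheme \<Rightarrow> 'a set \<Rightarrow> 'a set" where
  "sym_gens G X = X \<union> (\<lambda>x. inv\<^bsub>G\<^esub> x) ` X"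

abbreviation words :: "('a, 'b) monoid_scheme \<Rightarrow> 'a set \<Rightarrow> 'a list set" where
  "words G X \<equiv> lists (sym_gens G X)"

definition word_val :: "('a, 'b) monoid_scheme \<Rightarrow> 'a list \<Rightarrow> 'a" where
  "word_val G w = foldr (\<lambda>x y. x \<otimes>\<^bsub>G\<^esub> y) w \<one>\<^bsub>G\<^esub>"

text \<open>
  Words are handed to algorithms through an injective numbering \<open>e\<close> of the finite alphabet.
\<close>

definition word_code :: "('a \<Rightarrow> nat) \<Rightarrow> 'a list \<Rightarrow> nat" where
  "word_code e w = list_encode (map e w)"

definition geo_length :: "('a, 'b) monoid_scheme \<Rightarrow> 'a set \<Rightarrow> 'a \<Rightarrow> nat" where
  "geo_length G X g = (LEAST n. \<exists>w \<in> words G X. word_val G w = g \<and> length w = n)"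

definition conjugate_in :: "('a, 'b) monoid_scheme \<Rightarrow> 'a \<Rightarrow> 'a \<Rightarrow> bool" where
  "conjugate_in G x y \<longleftrightarrow> (\<exists>z \<in> carrier G. y = inv\<^bsub>G\<^esub> z \<otimes>\<^bsub>G\<^esub> x \<otimes>\<^bsub>G\<^esub> z)"

definition conj_length :: "('a, 'b) monoid_scheme \<Rightarrow> 'a set \<Rightarrow> 'a \<Rightarrow> nat" where
  "conj_length G X g = (LEAST n. \<exists>h \<in> carrier G. conjugate_in G g h \<and> geo_length G X h = n)"

definition conj_set :: "('a, 'b) monoid_scheme \<Rightarrow> 'a set \<Rightarrow> 'a set \<Rightarrow> 'a set" where
  "conj_set G U V = (\<Union>v\<in>V. (\<lambda>u. inv\<^bsub>G\<^esub> v \<otimes>\<^bsub>G\<^esub> u \<otimes>\<^bsub>G\<^esub> v) ` U)"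

definition ConjGeo :: "('a, 'b) monoid_scheme \<Rightarrow> 'a set \<Rightarrow> 'a set \<Rightarrow> 'a set \<Rightarrow> 'a list set" where
  "ConjGeo G X U V =
     {w \<in> words G X. length w = conj_length G X (word_val G w) \<and> word_val G w \<in> conj_set G U V}"

definition decidable_conjugacy ::
    "('a, 'b) monoid_scheme \<Rightarrow> 'a set \<Rightarrow> ('a \<Rightarrow> nat) \<Rightarrow> bool" where
  "decidable_conjugacy G X e \<longleftrightarrow>
     decidable_problem (words G X \<times> words G X)
       (\<lambda>(x, y). prod_encode (word_code e x, word_code e y))
       (\<lambda>(x, y). conjugate_in G (word_val G x) (word_val G y))"

definition decidable_membership ::
    "('a, 'b) monoid_scheme \<Rightarrow> 'a set \<Rightarrow> ('a \<Rightarrow> nat) \<Rightarrow> (nat \<Rightarrow> 'a list set option) \<Rightarrow> bool" where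
  "decidable_membership G X e \<nu> \<longleftrightarrow>
     decidable_problem (dom \<nu> \<times> words G X)
       (\<lambda>(l, w). prod_encode (l, word_code e w))
       (\<lambda>(l, w). w \<in> the (\<nu> l))"

definition computable_ConjGeo ::
    "('a, 'b) monoid_scheme \<Rightarrow> 'a set \<Rightarrow> (nat \<Rightarrow> 'a set option) \<Rightarrow> (nat \<Rightarrow> 'a list set option) \<Rightarrow> bool"
  where
  "computable_ConjGeo G X \<nu>C \<nu>L \<longleftrightarrow>
     computable_description (dom \<nu>C \<times> dom \<nu>C) prod_encode
       (\<lambda>(u, v). ConjGeo G X (the (\<nu>C u)) (the (\<nu>C v))) \<nu>L"

definition computable_translation ::
    "('a, 'b) monoid_scheme \<Rightarrow> 'a set \<Rightarrow> ('a \<Rightarrow> nat) \<Rightarrow> (nat \<Rightarrow> 'a set option) \<Rightarrow> bool" where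
  "computable_translation G X e \<nu>C \<longleftrightarrow>
     computable_description (dom \<nu>C \<times> words G X)
       (\<lambda>(u, w). prod_encode (u, word_code e w))
       (\<lambda>(u, w). the (\<nu>C u) #>\<^bsub>G\<^esub> word_val G w) \<nu>C"

definition decidable_generalized_conjugacy ::
    "('a, 'b) monoid_scheme \<Rightarrow> 'a set \<Rightarrow> ('a \<Rightarrow> nat) \<Rightarrow> (nat \<Rightarrow> 'a set option) \<Rightarrow> bool" where
  "decidable_generalized_conjugacy G X e \<nu>C \<longleftrightarrow>
     decidable_problem (words G X \<times> dom \<nu>C \<times> dom \<nu>C)
       (\<lambda>(w, u, v). prod_encode (word_code e w, prod_encode (u, v)))
       (\<lambda>(w, u, v). \<exists>a \<in> the (\<nu>C u). \<exists>b \<in> the (\<nu>C v).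
          word_val G w = inv\<^bsub>G\<^esub> b \<otimes>\<^bsub>G\<^esub> a \<otimes>\<^bsub>G\<^esub> b)"

end

theory Submission
  imports Defs
begin

text \<open>
  Enumerating words in shortlex order, the first word \<open>h\<close> conjugate to the input \<open>g\<close> satisfies
  \<open>\<ell>(h) = |h|\<^sub>c\<close>. Since \<open>x = 1\<close> iff \<open>x\<close> is conjugate to \<open>1\<close>, the word problem is decidable, so an
  unbounded search finds \<open>z\<close> with \<open>h = z\<^sup>-\<^sup>1 g z\<close>. Now \<open>g = v\<^sup>-\<^sup>1 u v\<close> iff \<open>h = (v z)\<^sup>-\<^sup>1 u (v z)\<close>, so
  \<open>g \<in> \<alpha>(U, V)\<close> iff \<open>h \<in> ConjGeo(U, V z)\<close>, which can be decided.
\<close>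

section \<open>Recursive functions\<close>

abbreviation total_recursive :: "(nat \<Rightarrow> nat) \<Rightarrow> bool" where
  "total_recursive f \<equiv> partial_recursive (\<lambda>n. Some (f n))"

abbreviation fst_decode :: "nat \<Rightarrow> nat" where "fst_decode n \<equiv> fst (prod_decode n)"
abbreviation snd_decode :: "nat \<Rightarrow> nat" where "snd_decode n \<equiv> snd (prod_decode n)"

lemma partial_recursive_compose:
  assumes "partial_recursive f" "total_recursive h"
  shows "partial_recursive (\<lambda>n. f (h n))"
  using rec_comp[OF assms] by simp

lemmas total_recursive_compose = partial_recursive_compose[where f = "\<lambda>n. Some (f n)" for f]

text \<open>The identity is not a basic function here; it arises by pairing the two projections
  again.\<close>

lemma total_recursive_id: "total_recursive (\<lambda>n. n)"
  using rec_pair[OF rec_left rec_right] by simp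

lemma total_recursive_Suc: "total_recursive f \<Longrightarrow> total_recursive (\<lambda>n. Suc (f n))"
  by (rule total_recursive_compose[OF rec_succ])

lemma total_recursive_fst: "total_recursive f \<Longrightarrow> total_recursive (\<lambda>n. fst_decode (f n))"
  by (rule total_recursive_compose[OF rec_left])

lemma total_recursive_snd: "total_recursive f \<Longrightarrow> total_recursive (\<lambda>n. snd_decode (f n))"
  by (rule total_recursive_compose[OF rec_right])

lemma total_recursive_pair:
  "total_recursive f \<Longrightarrow> total_recursive g \<Longrightarrow> total_recursive (\<lambda>n. prod_encode (f n, g n))"
  using rec_pair[of "\<lambda>n. Some (f n)" "\<lambda>n. Some (g n)"] by simp

lemma total_recursive_const: "total_recursive (\<lambda>_. c)"
  by (induction c) (auto intro: rec_zero total_recursive_Suc)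

text \<open>When base and step are total, the \<open>None\<close> branch of \<open>rec_prec\<close>
  is never reached, so the recursion on options is \<open>Some\<close> of the plain one. Composing
  with \<open>n\<close> paired with \<open>h n\<close> lets the input itself serve as the
  parameter.\<close>

lemma total_recursive_rec_nat:
  assumes f: "total_recursive f" and h: "total_recursive h"
    and g: "total_recursive (\<lambda>p. g (fst_decode p) (fst_decode (snd_decode p))
      (snd_decode (snd_decode p)))"
  shows "total_recursive (\<lambda>n. rec_nat (f n) (g n) (h n))"
proof -
  have eq: "rec_nat (Some a) (\<lambda>k r. Option.bind r (\<lambda>i. Some (g n k i))) m = Some (rec_nat a (g n) m)"
    for a n m by (induction m) auto
  show ?thesis
    using partial_recursive_compose[OF rec_prec[OF f g]
        total_recursive_pair[OF total_recursive_id h]] by (simp add: eq)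
qed

text \<open>A primitive recursion whose step ignores the previous value is a case distinction; all
  branching below is built from it.\<close>

lemma total_recursive_case_nat:
  assumes "total_recursive f" "total_recursive h"
    and g: "total_recursive (\<lambda>p. g (fst_decode p) (snd_decode p))"
  shows "total_recursive (\<lambda>n. case h n of 0 \<Rightarrow> f n | Suc k \<Rightarrow> g n k)"
proof -
  have "total_recursive (\<lambda>p. prod_encode (fst_decode p, fst_decode (snd_decode p)))"
    by (intro total_recursive_pair total_recursive_fst total_recursive_snd total_recursive_id)
  from total_recursive_compose[OF g this]
  have "total_recursive (\<lambda>n. rec_nat (f n) (\<lambda>k r. g n k) (h n))"
    using assms(1,2) by (intro total_recursive_rec_nat) simp_all
  moreover have "rec_nat (f n) (\<lambda>k r. g n k) (h n) = (case h n of 0 \<Rightarrow> f n | Suc k \<Rightarrow> g n k)" for n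
    by (cases "h n") auto
  ultimately show ?thesis by simp
qed

lemmas total_recursive_intros = total_recursive_id total_recursive_const total_recursive_Suc
  total_recursive_fst total_recursive_snd total_recursive_pair total_recursive_case_nat

text \<open>This is the loop construct of the later lemmas: a state transition \<open>s\<close> is
  iterated a computable number of times, with data packed into the state by pairing.\<close>

lemma total_recursive_funpow:
  assumes s: "total_recursive s" and f: "total_recursive f" and h: "total_recursive h"
  shows "total_recursive (\<lambda>n. (s ^^ h n) (f n))"
proof -
  have "total_recursive (\<lambda>n. rec_nat (f n) (\<lambda>k r. s r) (h n))"
    by (intro total_recursive_rec_nat f h total_recursive_compose[OF s] total_recursive_intros)
  moreover have "rec_nat a (\<lambda>k r. s r) m = (s ^^ m) a" for a m by (induction m) auto
  ultimately show ?thesis by simp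
qed

text \<open>Truncated subtraction is iterated predecessor. It serves both for comparison and for
  negating a 0/1 answer.\<close>

lemma total_recursive_diff:
  assumes "total_recursive f" "total_recursive g"
  shows "total_recursive (\<lambda>n. f n - g n)"
proof -
  have "total_recursive (\<lambda>n. ((\<lambda>r. case r of 0 \<Rightarrow> 0 | Suc k \<Rightarrow> k) ^^ g n) (f n))"
    by (intro total_recursive_funpow assms total_recursive_intros)
  moreover have "((\<lambda>r. case r of 0 \<Rightarrow> 0 | Suc k \<Rightarrow> k) ^^ m) a = a - m" for a m :: nat
    by (induction m) (auto split: nat.split)
  ultimately show ?thesis by simp
qed

text \<open>Finitely many values can be hard-wired by nested case distinctions. This makes the
  arbitrary numbering \<open>e\<close> available to algorithms on the finite alphabet.\<close>

lemma total_recursive_table: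
  "\<exists>f. total_recursive f \<and> (\<forall>i<length xs. f i = xs ! i)"
proof (induction xs)
  case Nil
  then show ?case using rec_zero by auto
next
  case (Cons x xs)
  then obtain f where f: "total_recursive f" "\<forall>i<length xs. f i = xs ! i" by blast
  have "total_recursive (\<lambda>n. case n of 0 \<Rightarrow> x | Suc k \<Rightarrow> f k)"
    by (intro total_recursive_intros total_recursive_compose[OF f(1)])
  moreover have "\<forall>i<length (x # xs). (case i of 0 \<Rightarrow> x | Suc k \<Rightarrow> f k) = (x # xs) ! i"
    using f(2) by (auto split: nat.split)
  ultimately show ?case by blast
qed

text \<open>A counter holding quotient and remainder is incremented \<open>n\<close> times. The test
  \<open>k - Suc r = 0\<close> detects \<open>r + 1 \<ge> k\<close>, where the remainder is reset
  and the quotient carries.\<close>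

lemma total_recursive_divmod:
  assumes "k > 0"
  shows "total_recursive (\<lambda>n. prod_encode (n div k, n mod k))"
proof -
  define s where "s p = (case k - Suc (snd_decode p) of
      0 \<Rightarrow> prod_encode (Suc (fst_decode p), 0)
    | Suc _ \<Rightarrow> prod_encode (fst_decode p, Suc (snd_decode p)))" for p
  have "total_recursive s"
    unfolding s_def by (intro total_recursive_intros total_recursive_diff)
  then have "total_recursive (\<lambda>n. (s ^^ n) (prod_encode (0, 0)))"
    by (intro total_recursive_funpow total_recursive_intros)
  moreover have "(s ^^ n) (prod_encode (0, 0)) = prod_encode (n div k, n mod k)" for n
  proof (induction n)
    case (Suc n)
    have "n mod k < k" using assms by simp
    then show ?case
      using Suc by (auto simp: s_def div_Suc mod_Suc split: nat.split)
  qed simp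
  ultimately show ?thesis by simp
qed

section \<open>Concatenation on list codes\<close>

text \<open>The code of a list can therefore serve as the number of iterations of a loop that
  consumes the list.\<close>

lemma length_le_list_encode: "length xs \<le> list_encode xs"
proof (induction xs)
  case (Cons x xs)
  then show ?case using le_prod_encode_2[of "list_encode xs" x] by simp
qed simp

text \<open>The state pairs an accumulator with the remaining list, and each step moves one head
  across. A nonempty list has code \<open>Suc (prod_encode (head, tail))\<close>, so a case
  distinction on the code is one on the list. An empty remainder is a fixed point of
  \<open>s\<close>, which makes surplus iterations harmless.\<close>

lemma total_recursive_rev_append:
  assumes "total_recursive a" "total_recursive b"
  shows "total_recursive (\<lambda>n. list_encode (rev (list_decode (a n)) @ list_decode (b n)))"
proof -
  define s where "s p = (case snd_decode p of
      0 \<Rightarrow> p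
    | Suc c \<Rightarrow> prod_encode (Suc (prod_encode (fst_decode c, fst_decode p)), snd_decode c))" for p
  have s: "total_recursive s"
    unfolding s_def by (intro total_recursive_intros)
  have step: "(s ^^ m) (prod_encode (list_encode ys, list_encode xs))
      = prod_encode (list_encode (rev xs @ ys), 0)" if "length xs \<le> m" for m xs ys
    using that
  proof (induction m arbitrary: xs ys)
    case (Suc m)
    show ?case
    proof (cases xs)
      case Nil
      then show ?thesis using Suc.IH[of "[]" ys] by (simp add: s_def funpow_swap1[of s])
    next
      case (Cons x xs')
      then have "s (prod_encode (list_encode ys, list_encode xs))
          = prod_encode (list_encode (x # ys), list_encode xs')" by (simp add: s_def)
      then show ?thesis
        using Suc.IH[of xs' "x # ys"] Suc.prems Cons by (simp add: funpow_swap1)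
    qed
  qed simp
  have "total_recursive (\<lambda>n. fst_decode ((s ^^ a n) (prod_encode (b n, a n))))"
    by (intro total_recursive_intros total_recursive_funpow s assms)
  moreover have "fst_decode ((s ^^ a n) (prod_encode (b n, a n)))
      = list_encode (rev (list_decode (a n)) @ list_decode (b n))" for n
    using step[of "list_decode (a n)" "a n" "list_decode (b n)"]
      length_le_list_encode[of "list_decode (a n)"] by simp
  ultimately show ?thesis by simp
qed

text \<open>Reversing the first list onto the empty list, and the result onto the second list,
  restores the order.\<close>

lemma total_recursive_append:
  assumes "total_recursive a" "total_recursive b"
  shows "total_recursive (\<lambda>n. list_encode (list_decode (a n) @ list_decode (b n)))"
proof -
  have "total_recursive (\<lambda>n. list_encode (rev (list_decode (a n)) @ list_decode 0))"
    by (intro total_recursive_rev_append assms total_recursive_intros)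
  from total_recursive_rev_append[OF this assms(2)] show ?thesis by simp
qed

section \<open>Sequencing and unbounded search for partial functions\<close>

text \<open>The second computation may use the original input as well as the result of the first, so
  the input is carried along in a pair.\<close>

lemma partial_recursive_bind:
  assumes f: "partial_recursive f"
    and g: "partial_recursive (\<lambda>p. g (fst_decode p) (snd_decode p))"
  shows "partial_recursive (\<lambda>n. Option.bind (f n) (g n))"
proof -
  have "partial_recursive (\<lambda>n. Option.bind (Option.bind (f n) (\<lambda>a. Some (prod_encode (n, a))))
      (\<lambda>p. g (fst_decode p) (snd_decode p)))"
    using rec_comp[OF g rec_pair[OF total_recursive_id f]] by simp
  then show ?thesis by (simp add: Option.bind_assoc)
qed

text \<open>\<open>rec_mu\<close> looks for the value 0 while deciders answer 1 for yes, hence the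
  flip \<open>1 - r\<close>. The guarantee is stated per input \<open>n\<close>, because a decider
  is only known to answer correctly on codes of instances.\<close>

lemma partial_recursive_search:
  assumes "partial_recursive f"
  obtains g where "partial_recursive g"
    and "\<And>n P. \<lbrakk>\<And>m. f (prod_encode (n, m)) = Some (if P m then 1 else 0); \<exists>m. P m\<rbrakk>
      \<Longrightarrow> g n = Some (LEAST m. P m)"
proof -
  define h where "h n = Option.bind (f n) (\<lambda>r. Some (1 - r))" for n
  have "partial_recursive h"
    unfolding h_def
    by (intro partial_recursive_bind assms total_recursive_diff total_recursive_intros)
  from rec_mu[OF this] show ?thesis
  proof (rule that)
    fix n and P :: "nat \<Rightarrow> bool"
    assume f: "\<And>m. f (prod_encode (n, m)) = Some (if P m then 1 else 0)" and ex: "\<exists>m. P m"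
    have h: "h (prod_encode (n, m)) = Some (if P m then 0 else Suc 0)" for m
      by (simp add: h_def f)
    have "P (LEAST m. P m)" using ex by (rule LeastI_ex)
    moreover have "\<forall>k<LEAST m. P m. \<not> P k" using not_less_Least by blast
    ultimately have "\<exists>m. P m \<and> (\<forall>k<m. \<not> P k)" by blast
    then have "\<exists>m. h (prod_encode (n, m)) = Some 0 \<and>
        (\<forall>k<m. \<exists>y. h (prod_encode (n, k)) = Some (Suc y))"
      by (auto simp: h)
    then show "(if \<exists>m. h (prod_encode (n, m)) = Some 0 \<and>
          (\<forall>k<m. \<exists>y. h (prod_encode (n, k)) = Some (Suc y))
        then Some (LEAST m. h (prod_encode (n, m)) = Some 0) else None) = Some (LEAST m. P m)"
      by (simp only: if_True) (simp add: h)
  qed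
qed

section \<open>The shortlex enumeration\<close>

text \<open>This is bijective numeration in base \<open>length as\<close>: the last digit of
  \<open>Suc n\<close> is \<open>n mod length as\<close>, and the remaining digits form word number
  \<open>n div length as\<close>. Repeated letters in \<open>as\<close> only make words
  recur.\<close>

function shortlex :: "'a list \<Rightarrow> nat \<Rightarrow> 'a list" where
  "shortlex as 0 = []"
| "shortlex as (Suc n) = (if as = [] then []
    else shortlex as (n div length as) @ [as ! (n mod length as)])"
  by pat_completeness auto
termination
  by (relation "measure snd") (auto simp: le_imp_less_Suc)

lemma set_shortlex: "set (shortlex as n) \<subseteq> set as"
  by (induction as n rule: shortlex.induct) auto

lemma shortlex_surj:
  assumes "set w \<subseteq> set as"
  shows "\<exists>n. shortlex as n = w"
  using assms
proof (induction w rule: rev_induct)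
  case Nil
  then show ?case by (metis shortlex.simps(1))
next
  case (snoc a w)
  then obtain n where n: "shortlex as n = w" by auto
  from snoc.prems obtain i where i: "i < length as" "as ! i = a"
    by (auto simp: in_set_conv_nth)
  then have "shortlex as (Suc (n * length as + i)) = w @ [a]"
    using n by auto
  then show ?case by blast
qed

text \<open>Division by \<open>length as\<close> is monotone and each division contributes one
  letter. Together with surjectivity this makes the first enumerated word with a given property a
  shortest one.\<close>

lemma length_shortlex_mono: "m \<le> n \<Longrightarrow> length (shortlex as m) \<le> length (shortlex as n)"
proof (induction n arbitrary: m rule: less_induct)
  case (less n)
  show ?case
  proof (cases "m = 0 \<or> as = []")
    case True
    then show ?thesis by (cases m) auto
  next
    case False
    then obtain m' n' where "m = Suc m'" "n = Suc n'" "m' \<le> n'"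
      using less.prems by (metis Suc_le_D Suc_le_mono not0_implies_Suc)
    then show ?thesis
      using less.IH[of "n' div length as" "m' div length as"] False
      by (simp add: div_le_mono le_imp_less_Suc)
  qed
qed

text \<open>The state pairs the suffix built so far with the index of the missing prefix. Each step
  splits off the last letter of that prefix and prepends its tabulated code to the suffix. The index
  strictly decreases until it reaches the fixed point 0, so \<open>n\<close> iterations
  suffice.\<close>

lemma total_recursive_shortlex: "total_recursive (\<lambda>n. word_code e (shortlex as n))"
proof (cases "as = []")
  case True
  then have "shortlex as n = []" for n by (cases n) auto
  then show ?thesis by (simp add: total_recursive_const)
next
  case False
  obtain l where l: "total_recursive l" "\<forall>i<length as. l i = map e as ! i"
    using total_recursive_table[of "map e as"] by auto
  define d where "d n = prod_encode (n div length as, n mod length as)" for n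
  have d: "total_recursive d"
    unfolding d_def using False by (simp add: total_recursive_divmod)
  define s where "s p = (case snd_decode p of
      0 \<Rightarrow> p
    | Suc n \<Rightarrow> prod_encode (Suc (prod_encode (l (snd_decode (d n)), fst_decode p)),
        fst_decode (d n)))" for p
  have s: "total_recursive s"
    unfolding s_def
    by (intro total_recursive_intros total_recursive_compose[OF l(1)] total_recursive_compose[OF d])
  have step: "(s ^^ m) (prod_encode (word_code e w, n))
      = prod_encode (word_code e (shortlex as n @ w), 0)" if "n \<le> m" for m n w
    using that
  proof (induction m arbitrary: n w)
    case (Suc m)
    show ?case
    proof (cases n)
      case 0
      then show ?thesis using Suc.IH[of 0 w] by (simp add: s_def funpow_swap1[of s])
    next
      case (Suc n')
      then have "s (prod_encode (word_code e w, n))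
          = prod_encode (word_code e (as ! (n' mod length as) # w), n' div length as)"
        using l(2) False by (simp add: s_def d_def word_code_def)
      moreover have "n' div length as \<le> m"
        using Suc.prems \<open>n = Suc n'\<close> by (meson Suc_le_mono div_le_dividend le_trans)
      ultimately show ?thesis
        using Suc.IH[of "n' div length as" "as ! (n' mod length as) # w"] Suc False
        by (simp add: funpow_swap1)
    qed
  qed simp
  have "total_recursive (\<lambda>n. fst_decode ((s ^^ n) (prod_encode (word_code e [], n))))"
    by (intro total_recursive_intros total_recursive_funpow s)
  then show ?thesis by (simp add: step)
qed

lemma list_encode_append_word_code:
  "list_encode (list_decode (word_code e v) @ list_decode (word_code e w)) = word_code e (v @ w)"
  by (simp add: word_code_def)

section \<open>Words and conjugacy in a group\<close>

context group
begin

lemma sym_gens_closed: "X \<subseteq> carrier G \<Longrightarrow> sym_gens G X \<subseteq> carrier G"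
  by (auto simp: sym_gens_def)

lemma word_val_Nil [simp]: "word_val G [] = \<one>"
  by (simp add: word_val_def)

lemma word_val_Cons [simp]: "word_val G (x # w) = x \<otimes> word_val G w"
  by (simp add: word_val_def)

lemma word_val_closed:
  "X \<subseteq> carrier G \<Longrightarrow> w \<in> words G X \<Longrightarrow> word_val G w \<in> carrier G"
  using sym_gens_closed[of X] by (induction w) auto

lemma word_val_append:
  assumes "X \<subseteq> carrier G" "v \<in> words G X" "w \<in> words G X"
  shows "word_val G (v @ w) = word_val G v \<otimes> word_val G w"
  using assms(2)
proof (induction v)
  case Nil
  then show ?case using word_val_closed[OF assms(1,3)] by simp
next
  case (Cons x v)
  then show ?case
    using assms sym_gens_closed[of X] word_val_closed[of X v] word_val_closed[of X w]
    by (auto simp: m_assoc)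
qed

lemma word_val_surj:
  assumes "X \<subseteq> carrier G" "g \<in> generate G X"
  shows "\<exists>w\<in>words G X. word_val G w = g"
  using assms(2)
proof induction
  case one
  then show ?case by (intro bexI[of _ "[]"]) auto
next
  case (incl h)
  then show ?case using assms(1) by (intro bexI[of _ "[h]"]) (auto simp: sym_gens_def)
next
  case (inv h)
  then show ?case using assms(1) by (intro bexI[of _ "[inv h]"]) (auto simp: sym_gens_def)
next
  case (eng g h)
  then obtain v w where "v \<in> words G X" "word_val G v = g" "w \<in> words G X" "word_val G w = h"
    by blast
  then show ?case using word_val_append[OF assms(1)] by (intro bexI[of _ "v @ w"]) auto
qed

lemma conjugate_in_refl: "x \<in> carrier G \<Longrightarrow> conjugate_in G x x"
  unfolding conjugate_in_def by (rule bexI[of _ \<one>]) auto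

lemma conjugate_in_trans:
  assumes "conjugate_in G x y" "conjugate_in G y z" "x \<in> carrier G"
  shows "conjugate_in G x z"
proof -
  from assms obtain a b where ab: "a \<in> carrier G" "y = inv a \<otimes> x \<otimes> a"
    "b \<in> carrier G" "z = inv b \<otimes> y \<otimes> b"
    by (auto simp: conjugate_in_def)
  then have "z = inv (a \<otimes> b) \<otimes> x \<otimes> (a \<otimes> b)"
    using assms(3) by (simp add: m_assoc inv_mult_group)
  then show ?thesis using ab by (auto simp: conjugate_in_def)
qed

text \<open>Undoing the conjugation by \<open>z\<close> turns 1 back into 1. This is what reduces
  the word problem to the conjugacy problem.\<close>

lemma conjugate_in_one_iff:
  assumes "x \<in> carrier G"
  shows "conjugate_in G x \<one> \<longleftrightarrow> x = \<one>"
proof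
  assume "conjugate_in G x \<one>"
  then obtain z where z: "z \<in> carrier G" "\<one> = inv z \<otimes> x \<otimes> z"
    by (auto simp: conjugate_in_def)
  have "x = (z \<otimes> inv z) \<otimes> x \<otimes> (z \<otimes> inv z)" using z(1) assms by simp
  also have "\<dots> = z \<otimes> (inv z \<otimes> x \<otimes> z) \<otimes> inv z"
    using z(1) assms by (simp only: m_assoc inv_closed m_closed)
  also have "\<dots> = \<one>" using z(1) by (simp only: z(2)[symmetric] r_one r_inv)
  finally show "x = \<one>" .
qed (use conjugate_in_refl in simp)

text \<open>Conjugating by \<open>v z\<close> means conjugating by \<open>v\<close> and then by
  \<open>z\<close>, and conjugation by \<open>z\<close> is injective. The set \<open>U\<close> stays
  fixed while \<open>V\<close> absorbs \<open>z\<close> on the right.\<close>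

lemma conj_set_translate:
  assumes "U \<subseteq> carrier G" "V \<subseteq> carrier G" "g \<in> carrier G" "z \<in> carrier G"
  shows "inv z \<otimes> g \<otimes> z \<in> conj_set G U (V #> z) \<longleftrightarrow> g \<in> conj_set G U V"
proof -
  have "inv z \<otimes> g \<otimes> z = inv (v \<otimes> z) \<otimes> u \<otimes> (v \<otimes> z) \<longleftrightarrow> g = inv v \<otimes> u \<otimes> v"
    if "u \<in> U" "v \<in> V" for u v
  proof -
    have uv: "u \<in> carrier G" "v \<in> carrier G" using assms that by auto
    then have "inv (v \<otimes> z) \<otimes> u \<otimes> (v \<otimes> z) = inv z \<otimes> (inv v \<otimes> u \<otimes> v) \<otimes> z"
      using assms by (simp add: m_assoc inv_mult_group)
    then show ?thesis using uv assms by simp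
  qed
  then show ?thesis by (auto simp: conj_set_def r_coset_def)
qed

text \<open>A geodesic word for any conjugate of the first hit also represents a conjugate of
  \<open>g\<close>, so it is enumerated no earlier and is at least as long. Applied to the element
  of the first hit itself, this shows that the hit is geodesic; applied to all its conjugates, that
  its length is the conjugacy length.\<close>

lemma first_conjugate_length:
  assumes X: "X \<subseteq> carrier G" "generate G X = carrier G"
    and as: "set as = sym_gens G X" and g: "g \<in> carrier G"
    and m: "m = (LEAST m. conjugate_in G g (word_val G (shortlex as m)))"
    and conj: "conjugate_in G g (word_val G (shortlex as m))"
  shows "length (shortlex as m) = conj_length G X (word_val G (shortlex as m))"
proof -
  define w where "w = shortlex as m"
  have w: "w \<in> words G X" using set_shortlex[of as m] as by (auto simp: w_def)
  then have wc: "word_val G w \<in> carrier G" by (rule word_val_closed[OF X(1)])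
  have lower: "length w \<le> geo_length G X h" if h: "h \<in> carrier G" "conjugate_in G (word_val G w) h" for h
  proof -
    have "\<exists>n. \<exists>v\<in>words G X. word_val G v = h \<and> length v = n"
      using word_val_surj[OF X(1)] X(2) h(1) by blast
    from LeastI_ex[OF this] obtain v where v: "v \<in> words G X" "word_val G v = h"
      "length v = geo_length G X h" by (auto simp: geo_length_def)
    have "set v \<subseteq> set as" using v(1) as by auto
    then obtain k where k: "shortlex as k = v" using shortlex_surj by blast
    have "conjugate_in G g h"
      using conjugate_in_trans[OF _ h(2) g] conj by (simp add: w_def)
    then have "m \<le> k" unfolding m by (intro Least_le) (simp add: k v)
    then show ?thesis using length_shortlex_mono[of m k as] k v(3) by (simp add: w_def)
  qed
  have "geo_length G X (word_val G w) \<le> length w"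
    unfolding geo_length_def using w by (intro Least_le) blast
  with lower[OF wc conjugate_in_refl[OF wc]] have "geo_length G X (word_val G w) = length w"
    by simp
  then have "conj_length G X (word_val G w) = length w"
    unfolding conj_length_def using lower wc conjugate_in_refl[OF wc]
    by (intro Least_equality) auto
  then show ?thesis by (simp add: w_def)
qed

text \<open>
  The word problem is the conjugacy problem with the empty word, whose code is \<open>0\<close>; inverses are
  found by searching for a word \<open>v\<close> with \<open>w v = 1\<close>, to avoid computing with letters.
\<close>

lemma decidable_conjugacy_imp_inverse:
  assumes X: "X \<subseteq> carrier G" "generate G X = carrier G"
    and as: "set as = sym_gens G X"
    and c: "partial_recursive c"
      "\<And>x y. x \<in> words G X \<Longrightarrow> y \<in> words G X \<Longrightarrow>
        c (prod_encode (word_code e x, word_code e y))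
          = Some (if conjugate_in G (word_val G x) (word_val G y) then 1 else 0)"
  obtains J where "partial_recursive J"
    and "\<And>w. w \<in> words G X \<Longrightarrow>
      \<exists>v\<in>words G X. J (word_code e w) = Some (word_code e v) \<and> word_val G v = inv (word_val G w)"
proof -
  have short: "shortlex as m \<in> words G X" for m using set_shortlex[of as m] as by auto
  define t where "t p = c (prod_encode (list_encode (list_decode (fst_decode p)
      @ list_decode (word_code e (shortlex as (snd_decode p)))), 0))" for p
  have "partial_recursive t"
    unfolding t_def
    by (intro partial_recursive_compose[OF c(1)] total_recursive_intros total_recursive_append
        total_recursive_compose[OF total_recursive_shortlex])
  then obtain s where s: "partial_recursive s"
    "\<And>n P. \<lbrakk>\<And>m. t (prod_encode (n, m)) = Some (if P m then 1 else 0); \<exists>m. P m\<rbrakk>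
      \<Longrightarrow> s n = Some (LEAST m. P m)"
    using partial_recursive_search[of t] by blast
  define J where "J n = Option.bind (s n) (\<lambda>m. Some (word_code e (shortlex as m)))" for n
  have "partial_recursive J"
    unfolding J_def by (rule rec_comp[OF total_recursive_shortlex s(1)])
  moreover have "\<exists>v\<in>words G X. J (word_code e w) = Some (word_code e v)
      \<and> word_val G v = inv (word_val G w)" if w: "w \<in> words G X" for w
  proof -
    have wc: "word_val G w \<in> carrier G" using word_val_closed[OF X(1) w] .
    let ?P = "\<lambda>m. word_val G (shortlex as m) = inv (word_val G w)"
    have "t (prod_encode (word_code e w, m)) = Some (if ?P m then 1 else 0)" for m
    proof -
      have sc: "word_val G (shortlex as m) \<in> carrier G" using word_val_closed[OF X(1) short] .
      have "conjugate_in G (word_val G (w @ shortlex as m)) \<one> \<longleftrightarrow> ?P m"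
        using word_val_append[OF X(1) w short] conjugate_in_one_iff wc sc
        by (metis inv_equality inv_inv m_closed r_inv inv_comm)
      then show ?thesis
        using c(2)[of "w @ shortlex as m" "[]"] w short
        by (simp add: t_def list_encode_append_word_code) (simp add: word_code_def)
    qed
    moreover have "\<exists>m. ?P m"
    proof -
      obtain v where v: "v \<in> words G X" "word_val G v = inv (word_val G w)"
        using word_val_surj[OF X(1), of "inv (word_val G w)"] X(2) wc by auto
      then have "set v \<subseteq> set as" using as by auto
      then obtain m where "shortlex as m = v" using shortlex_surj by blast
      then show ?thesis using v by blast
    qed
    ultimately have "s (word_code e w) = Some (LEAST m. ?P m)" "?P (LEAST m. ?P m)"
      using s(2)[of "word_code e w" ?P] LeastI_ex[of ?P] by blast+
    then show ?thesis
      using short by (intro bexI[of _ "shortlex as (LEAST m. ?P m)"]) (auto simp: J_def)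
  qed
  ultimately show ?thesis using that by blast
qed

end

section \<open>The decision procedure for generalized conjugacy\<close>

theorem proposition3p3:
  fixes G :: "('a, 'b) monoid_scheme"
    and X :: "'a set"
    and e :: "'a \<Rightarrow> nat"
    and \<C> :: "'a set set" and \<nu>C :: "nat \<Rightarrow> 'a set option"
    and \<L> :: "'a list set set" and \<nu>L :: "nat \<Rightarrow> 'a list set option"
  assumes "group G"
    and "finite X" and "X \<subseteq> carrier G" and "generate G X = carrier G"
    and "inj_on e (sym_gens G X)"
    and "\<forall>U\<in>\<C>. U \<subseteq> carrier G" and "finitely_described \<C> \<nu>C"
    and "\<forall>L\<in>\<L>. L \<subseteq> words G X" and "finitely_described \<L> \<nu>L"
    and i: "\<forall>U\<in>\<C>. \<forall>V\<in>\<C>. ConjGeo G X U V \<in> \<L>" "computable_ConjGeo G X \<nu>C \<nu>L"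
    and ii: "\<forall>U\<in>\<C>. \<forall>g\<in>carrier G. U #>\<^bsub>G\<^esub> g \<in> \<C>" "computable_translation G X e \<nu>C"
    and iii: "decidable_conjugacy G X e"
    and iv: "decidable_membership G X e \<nu>L"
  shows "decidable_generalized_conjugacy G X e \<nu>C"
proof -
  interpret group G by fact
  note X = \<open>X \<subseteq> carrier G\<close> \<open>generate G X = carrier G\<close>
  note closed = word_val_closed[OF X(1)] and append = word_val_append[OF X(1)]
  have "finite (sym_gens G X)" using \<open>finite X\<close> by (simp add: sym_gens_def)
  then obtain as where as: "set as = sym_gens G X" using finite_list by blast
  let ?w = "shortlex as" and ?code = "word_code e"
  have short: "?w m \<in> words G X" for m using set_shortlex[of as m] as by auto
  have surj: "\<exists>m. word_val G (?w m) = g" if "g \<in> carrier G" for g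
  proof -
    obtain v where v: "v \<in> words G X" "word_val G v = g"
      using word_val_surj[OF X(1)] X(2) \<open>g \<in> carrier G\<close> by auto
    then have "set v \<subseteq> set as" using as by auto
    then show ?thesis using shortlex_surj v by metis
  qed

  \<comment> \<open>The four hypotheses yield algorithms: \<open>c\<close> decides conjugacy,
    \<open>q\<close> computes descriptions of \<open>ConjGeo\<close> sets, \<open>t\<close> computes
    right translates and \<open>r\<close> decides membership.\<close>
  obtain c where c: "partial_recursive c"
    "\<And>x y. x \<in> words G X \<Longrightarrow> y \<in> words G X \<Longrightarrow> c (prod_encode (?code x, ?code y))
      = Some (if conjugate_in G (word_val G x) (word_val G y) then 1 else 0)"
    using iii unfolding decidable_conjugacy_def decidable_problem_def
      split_paired_Ball_Sigma prod.case by blast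
  obtain q where q: "partial_recursive q"
    "\<And>u v. u \<in> dom \<nu>C \<Longrightarrow> v \<in> dom \<nu>C \<Longrightarrow> \<exists>l. q (prod_encode (u, v)) = Some l
      \<and> \<nu>L l = Some (ConjGeo G X (the (\<nu>C u)) (the (\<nu>C v)))"
    using i(2) unfolding computable_ConjGeo_def computable_description_def
      split_paired_Ball_Sigma prod.case by blast
  obtain t where t: "partial_recursive t"
    "\<And>v z. v \<in> dom \<nu>C \<Longrightarrow> z \<in> words G X \<Longrightarrow> \<exists>d. t (prod_encode (v, ?code z)) = Some d
      \<and> \<nu>C d = Some (the (\<nu>C v) #>\<^bsub>G\<^esub> word_val G z)"
    using ii(2) unfolding computable_translation_def computable_description_def
      split_paired_Ball_Sigma prod.case by blast
  obtain r where r: "partial_recursive r"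
    "\<And>l w. l \<in> dom \<nu>L \<Longrightarrow> w \<in> words G X \<Longrightarrow> r (prod_encode (l, ?code w))
      = Some (if w \<in> the (\<nu>L l) then 1 else 0)"
    using iv unfolding decidable_membership_def decidable_problem_def
      split_paired_Ball_Sigma prod.case by blast
  obtain J where J: "partial_recursive J"
    "\<And>w. w \<in> words G X \<Longrightarrow> \<exists>v\<in>words G X. J (?code w) = Some (?code v)
      \<and> word_val G v = inv\<^bsub>G\<^esub> (word_val G w)"
    using decidable_conjugacy_imp_inverse[OF X as c] by blast

  \<comment> \<open>From the code of \<open>g\<close>, \<open>A\<close> will find the index of the
    first enumerated word conjugate to \<open>g\<close>.\<close>
  have "partial_recursive (\<lambda>p. c (prod_encode (fst_decode p, ?code (?w (snd_decode p)))))"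
    by (intro partial_recursive_compose[OF c(1)] total_recursive_intros
        total_recursive_compose[OF total_recursive_shortlex])
  then obtain A where A: "partial_recursive A"
    "\<And>n P. \<lbrakk>\<And>m. c (prod_encode (n, ?code (?w m))) = Some (if P m then 1 else 0); \<exists>m. P m\<rbrakk>
      \<Longrightarrow> A n = Some (LEAST m. P m)"
    by (rule partial_recursive_search) auto

  \<comment> \<open>On \<open>((g, h), k)\<close>, with \<open>z\<close> the \<open>k\<close>-th word: is \<open>z\<^sup>-\<^sup>1 g\<close> equal to \<open>h z\<^sup>-\<^sup>1\<close>?\<close>
  define b where "b p = Option.bind (J (?code (?w (snd_decode p)))) (\<lambda>z'.
      Option.bind (J (list_encode (list_decode (snd_decode (fst_decode p)) @ list_decode z')))
      (\<lambda>y. c (prod_encode (list_encode (list_decode (list_encode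
        (list_decode z' @ list_decode (fst_decode (fst_decode p)))) @ list_decode y), 0))))" for p
  have "partial_recursive b"
    unfolding b_def
    by (intro partial_recursive_bind partial_recursive_compose[OF c(1)]
        partial_recursive_compose[OF J(1)] total_recursive_intros total_recursive_append
        total_recursive_compose[OF total_recursive_shortlex])
  then obtain B where B: "partial_recursive B"
    "\<And>n P. \<lbrakk>\<And>m. b (prod_encode (n, m)) = Some (if P m then 1 else 0); \<exists>m. P m\<rbrakk>
      \<Longrightarrow> B n = Some (LEAST m. P m)"
    using partial_recursive_search[of b] by blast
  have b: "b (prod_encode (prod_encode (?code g, ?code h), k))
      = Some (if word_val G h = inv\<^bsub>G\<^esub> (word_val G (?w k)) \<otimes>\<^bsub>G\<^esub> word_val G g \<otimes>\<^bsub>G\<^esub> word_val G (?w k)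
        then 1 else 0)"
    if g: "g \<in> words G X" and h: "h \<in> words G X" for g h k
  proof -
    obtain z' where z': "z' \<in> words G X" "J (?code (?w k)) = Some (?code z')"
      "word_val G z' = inv\<^bsub>G\<^esub> (word_val G (?w k))" using J(2)[OF short] by blast
    have "h @ z' \<in> words G X" using h z'(1) by simp
    from J(2)[OF this] obtain y where y: "y \<in> words G X" "J (?code (h @ z')) = Some (?code y)"
      "word_val G y = inv\<^bsub>G\<^esub> (word_val G (h @ z'))" by blast
    have zg: "z' @ g \<in> words G X" using g z' by simp
    have zgy: "(z' @ g) @ y \<in> words G X" using g z' y by simp
    note cl = closed[OF g] closed[OF h] closed[OF short[of k]] closed[OF z'(1)] closed[OF y(1)]
    \<comment> \<open>The word read off is \<open>z^-1 g (h z^-1)^-1\<close>, whose value is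
      \<open>z^-1 g z h^-1\<close>; it is trivial exactly when \<open>h = z^-1 g z\<close>.\<close>
    have "word_val G ((z' @ g) @ y)
        = (inv\<^bsub>G\<^esub> (word_val G (?w k)) \<otimes>\<^bsub>G\<^esub> word_val G g)
          \<otimes>\<^bsub>G\<^esub> inv\<^bsub>G\<^esub> (word_val G h \<otimes>\<^bsub>G\<^esub> inv\<^bsub>G\<^esub> (word_val G (?w k)))"
      using append[OF zg y(1)] append[OF z'(1) g] append[OF h z'(1)] y(3) z'(3) by simp
    also have "\<dots> = inv\<^bsub>G\<^esub> (word_val G (?w k)) \<otimes>\<^bsub>G\<^esub> word_val G g \<otimes>\<^bsub>G\<^esub> word_val G (?w k)
        \<otimes>\<^bsub>G\<^esub> inv\<^bsub>G\<^esub> (word_val G h)"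
      using cl by (simp add: inv_mult_group m_assoc)
    finally have val: "word_val G ((z' @ g) @ y) = \<dots>" .
    have "conjugate_in G (word_val G ((z' @ g) @ y)) \<one>\<^bsub>G\<^esub> \<longleftrightarrow>
        inv\<^bsub>G\<^esub> (word_val G (?w k)) \<otimes>\<^bsub>G\<^esub> word_val G g \<otimes>\<^bsub>G\<^esub> word_val G (?w k) = word_val G h"
      unfolding conjugate_in_one_iff[OF closed[OF zgy]] unfolding val using cl
      by (metis inv_closed inv_equality inv_inv m_closed r_inv)
    then have "conjugate_in G (word_val G ((z' @ g) @ y)) \<one>\<^bsub>G\<^esub> \<longleftrightarrow>
        word_val G h = inv\<^bsub>G\<^esub> (word_val G (?w k)) \<otimes>\<^bsub>G\<^esub> word_val G g \<otimes>\<^bsub>G\<^esub> word_val G (?w k)"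
      by auto
    moreover have "?code [] = 0" by (simp add: word_code_def)
    moreover have "b (prod_encode (prod_encode (?code g, ?code h), k))
        = c (prod_encode (?code ((z' @ g) @ y), 0))"
      using z'(2) y(2)
      by (simp only: b_def prod_encode_inverse fst_conv snd_conv bind.simps
          list_encode_append_word_code)
    ultimately show ?thesis using c(2)[OF zgy, of "[]"] by simp
  qed

  \<comment> \<open>On the input \<open>(g, (u, v))\<close>: \<open>m\<close> is the index of the
    short conjugate \<open>h\<close>, \<open>k\<close> that of a conjugator \<open>z\<close>,
    \<open>d\<close> describes the translate of \<open>V\<close> by \<open>z\<close>, and
    \<open>l\<close> describes \<open>ConjGeo\<close> of \<open>U\<close> and that translate. The
    answer is whether \<open>h\<close> lies in it.\<close>
  define D where "D n = Option.bind (A (fst_decode n)) (\<lambda>m.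
      Option.bind (B (prod_encode (fst_decode n, ?code (?w m)))) (\<lambda>k.
      Option.bind (t (prod_encode (snd_decode (snd_decode n), ?code (?w k)))) (\<lambda>d.
      Option.bind (q (prod_encode (fst_decode (snd_decode n), d))) (\<lambda>l.
      r (prod_encode (l, ?code (?w m)))))))" for n
  have "partial_recursive D"
    unfolding D_def
    by (intro partial_recursive_bind partial_recursive_compose[OF A(1)]
        partial_recursive_compose[OF B(1)] partial_recursive_compose[OF t(1)]
        partial_recursive_compose[OF q(1)] partial_recursive_compose[OF r(1)]
        total_recursive_intros total_recursive_compose[OF total_recursive_shortlex])
  moreover have "D (prod_encode (?code g, prod_encode (u, v)))
      = Some (if \<exists>a\<in>the (\<nu>C u). \<exists>b\<in>the (\<nu>C v). word_val G g = inv\<^bsub>G\<^esub> b \<otimes>\<^bsub>G\<^esub> a \<otimes>\<^bsub>G\<^esub> b then 1 else 0)"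
    if g: "g \<in> words G X" and u: "u \<in> dom \<nu>C" and v: "v \<in> dom \<nu>C" for g u v
  proof -
    let ?g = "word_val G g" and ?U = "the (\<nu>C u)" and ?V = "the (\<nu>C v)"
    let ?P = "\<lambda>m. conjugate_in G ?g (word_val G (?w m))"
    define m where "m = (LEAST m. ?P m)"
    have gc: "?g \<in> carrier G" using closed[OF g] .
    \<comment> \<open>The first search halts because some enumerated word represents
      \<open>g\<close> itself.\<close>
    have ex: "\<exists>m. ?P m" using surj[OF gc] conjugate_in_refl[OF gc] by metis
    have Am: "A (?code g) = Some m"
      unfolding m_def using A(2)[of "?code g" ?P] c(2)[OF g short] ex by blast
    have Pm: "?P m" unfolding m_def using ex by (rule LeastI_ex)
    let ?Q = "\<lambda>k. word_val G (?w m)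
      = inv\<^bsub>G\<^esub> (word_val G (?w k)) \<otimes>\<^bsub>G\<^esub> ?g \<otimes>\<^bsub>G\<^esub> word_val G (?w k)"
    define k where "k = (LEAST k. ?Q k)"
    \<comment> \<open>The second search halts because the conjugator provided by \<open>?P m\<close>
      is represented by some enumerated word.\<close>
    have exQ: "\<exists>k. ?Q k" using Pm surj unfolding conjugate_in_def by metis
    have Bk: "B (prod_encode (?code g, ?code (?w m))) = Some k"
      unfolding k_def using B(2)[of _ ?Q] b[OF g short] exQ by blast
    have Qk: "?Q k" unfolding k_def using exQ by (rule LeastI_ex)
    obtain d where d: "t (prod_encode (v, ?code (?w k))) = Some d"
      "\<nu>C d = Some (?V #>\<^bsub>G\<^esub> word_val G (?w k))" using t(2)[OF v short] by blast
    then have "d \<in> dom \<nu>C" by blast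
    from q(2)[OF u this] d obtain l where l: "q (prod_encode (u, d)) = Some l"
      "\<nu>L l = Some (ConjGeo G X ?U (?V #>\<^bsub>G\<^esub> word_val G (?w k)))" by auto
    have "?U \<in> \<C>" "?V \<in> \<C>"
      using u v \<open>finitely_described \<C> \<nu>C\<close> by (auto simp: finitely_described_def ran_def)
    then have UV: "?U \<subseteq> carrier G" "?V \<subseteq> carrier G" using \<open>\<forall>U\<in>\<C>. U \<subseteq> carrier G\<close> by auto
    \<comment> \<open>The length condition in \<open>ConjGeo\<close> holds by the choice of
      \<open>m\<close>, so only membership in \<open>conj_set\<close> is left to test.\<close>
    have "?w m \<in> the (\<nu>L l) \<longleftrightarrow> word_val G (?w m) \<in> conj_set G ?U (?V #>\<^bsub>G\<^esub> word_val G (?w k))"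
      using first_conjugate_length[OF X as gc m_def Pm] short l(2) by (simp add: ConjGeo_def)
    also have "\<dots> \<longleftrightarrow> ?g \<in> conj_set G ?U ?V"
      using conj_set_translate[OF UV gc closed[OF short[of k]]] Qk by simp
    also have "\<dots> \<longleftrightarrow> (\<exists>a\<in>?U. \<exists>b\<in>?V. ?g = inv\<^bsub>G\<^esub> b \<otimes>\<^bsub>G\<^esub> a \<otimes>\<^bsub>G\<^esub> b)"
      by (auto simp: conj_set_def)
    finally have "?w m \<in> the (\<nu>L l) \<longleftrightarrow> (\<exists>a\<in>?U. \<exists>b\<in>?V. ?g = inv\<^bsub>G\<^esub> b \<otimes>\<^bsub>G\<^esub> a \<otimes>\<^bsub>G\<^esub> b)" .
    moreover have "l \<in> dom \<nu>L" using l by blast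
    ultimately show ?thesis
      using r(2)[of l "?w m"] short[of m] by (simp add: D_def Am Bk d l)
  qed
  ultimately show ?thesis
    unfolding decidable_generalized_conjugacy_def decidable_problem_def
    by (intro exI[of _ D] conjI) auto
qed

end
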